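(* Let $(p_n)_{n\ge 0}$ be the sequence defined by $p_0=1$, $p_1=0$ and $$p_{n+1}=(2n+1)p_n+p_{n-1}\qquad (n\ge 1).$$ Then for every $n\ge 0$, $p_n$ equals the number of ordered Carlitz words of $1^2,2^2,\ldots,n^2$.
   Context: A word of $1^k,2^k,\ldots,n^k$ is a sequence of length $kn$ in which each of the symbols $1,\ldots,n$ occurs exactly $k$ times (a multipermutation). It is Carlitz if no two adjacent entries are equal. It is ordered if the first occurrences of the symbols $1,2,\ldots,n$ appear in increasing order from left to right (i.e. the first occurrence of $i$ precedes the first occurrence of $i+1$). For $n=0$ the empty word is the unique such word. *)

theory Defs
  imports Main
begin

definition multiperm_words :: "nat \<Rightarrow> nat \<Rightarrow> nat list set" where
  "multiperm_words k n =
     {w. length w = k * n \<and> set w \<subseteq> {1..n} \<and> (\<forall>i\<in>{1..n}. count_list w i = k)}"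

definition first_occ :: "nat list \<Rightarrow> nat \<Rightarrow> nat" where
  "first_occ w i = (LEAST j. j < length w \<and> w ! j = i)"

text \<open>Only meaningful when each of the symbols \<open>1, \<dots>, n\<close> occurs in \<open>w\<close>, since otherwise
  \<^const>\<open>first_occ\<close> is unspecified.\<close>

definition ordered_word :: "nat \<Rightarrow> nat list \<Rightarrow> bool" where
  "ordered_word n w \<longleftrightarrow> (\<forall>i. 1 \<le> i \<and> i < n \<longrightarrow> first_occ w i < first_occ w (i + 1))"

text \<open>The Carlitz condition (no two adjacent entries are equal) is \<^const>\<open>distinct_adj\<close>.\<close>

definition ordered_carlitz_words :: "nat \<Rightarrow> nat \<Rightarrow> nat list set" where
  "ordered_carlitz_words k n = {w \<in> multiperm_words k n. distinct_adj w \<and> ordered_word n w}"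

lemma finite_ordered_carlitz_words: "finite (ordered_carlitz_words k n)"
proof (rule finite_subset)
  show "ordered_carlitz_words k n \<subseteq> {w. set w \<subseteq> {1..n} \<and> length w = k * n}"
    by (auto simp: ordered_carlitz_words_def multiperm_words_def)
  show "finite {w. set w \<subseteq> {1..n} \<and> length w = k * n}"
    by (rule finite_lists_length_eq) simp
qed

end

theory Submission
  imports Defs "HOL-Computational_Algebra.Polynomial"
begin

text \<open>
  Let \<open>W\<^sub>n(X)\<close> be the generating polynomial of the ordered words of \<open>1\<^sup>2, \<dots>, n\<^sup>2\<close> by the number of
  adjacent equal pairs. An ordered word on \<open>n + 1\<close> symbols starts with \<open>1\<close>, and deleting both
  copies of \<open>1\<close> and relabelling leaves an arbitrary ordered word on \<open>n\<close> symbols together with one of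
  the \<open>2n + 1\<close> positions of the second \<open>1\<close>. Inserting it in front creates a pair, inserting it
  into a pair destroys one, and elsewhere nothing changes, so
  \<open>W\<^sub>n\<^sub>+\<^sub>1 = (X + 2n) W\<^sub>n + (1 - X) W\<^sub>n'\<close>. By induction this yields
  \<open>W\<^sub>n' = W\<^sub>n + (1 - X) W\<^sub>n\<^sub>-\<^sub>1\<close>; evaluating both identities at \<open>X = 0\<close> gives the recurrence.
\<close>

section \<open>Adjacent equal pairs and insertion into words\<close>

fun adj_pairs :: "'a list \<Rightarrow> nat" where
  "adj_pairs (x # y # w) = (if x = y then 1 else 0) + adj_pairs (y # w)"
| "adj_pairs _ = 0"

lemma adj_pairs_eq_0_iff: "adj_pairs w = 0 \<longleftrightarrow> distinct_adj w"
  by (induction w rule: adj_pairs.induct) auto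

lemma adj_pairs_map: "inj f \<Longrightarrow> adj_pairs (map f w) = adj_pairs w"
  by (induction w rule: adj_pairs.induct) (auto simp: inj_eq)

definition insert_at :: "'a \<Rightarrow> nat \<Rightarrow> 'a list \<Rightarrow> 'a list" where
  "insert_at a j w = take j w @ a # drop j w"

lemma insert_at_0 [simp]: "insert_at a 0 w = a # w"
  and insert_at_Suc [simp]: "insert_at a (Suc j) (x # w) = x # insert_at a j w"
  by (simp_all add: insert_at_def)

lemma length_insert_at [simp]: "length (insert_at a j w) = Suc (length w)"
  by (simp add: insert_at_def)

lemma set_insert_at [simp]: "set (insert_at a j w) = insert a (set w)"
  by (metis Un_insert_right append_take_drop_id insert_at_def list.simps(15) set_append)

lemma count_list_insert_at [simp]:
  "count_list (insert_at a j w) i = count_list w i + (if i = a then 1 else 0)"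
proof -
  have "count_list w i = count_list (take j w) i + count_list (drop j w) i"
    by (metis append_take_drop_id count_list_append)
  then show ?thesis
    by (simp add: insert_at_def)
qed

text \<open>The inserted \<open>a\<close> is the only one in the result, so it marks the slot and
  splits the word uniquely.\<close>

lemma insert_at_inject:
  assumes "a \<notin> set v" "a \<notin> set w" "j \<le> length v" "k \<le> length w"
  shows "insert_at a j v = insert_at a k w \<longleftrightarrow> v = w \<and> j = k"
proof
  assume "insert_at a j v = insert_at a k w"
  moreover have "a \<notin> set (take j v)" "a \<notin> set (drop j v)"
    using assms by (meson in_set_takeD in_set_dropD)+
  ultimately have "take j v = take k w \<and> drop j v = drop k w"
    by (simp add: insert_at_def append_Cons_eq_iff)
  then show "v = w \<and> j = k"
    using assms by (metis append_take_drop_id length_take min.absorb2)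
qed auto

section \<open>Total weight over all insertion slots\<close>

abbreviation X :: "int poly" where
  "X \<equiv> [:0, 1:]"

definition pair_weight :: "'a list \<Rightarrow> int poly" where
  "pair_weight w = X ^ adj_pairs w"

text \<open>Let \<open>y # w\<close> have \<open>m\<close> pairs and \<open>L\<close> slots after
  \<open>y\<close>. A new symbol splits a pair in \<open>m\<close> slots and changes nothing in the
  other \<open>L - m\<close>; the total \<open>m X^(m-1) + (L - m) X^m\<close> equals
  \<open>L X^m + (1 - X) m X^(m-1)\<close>.\<close>

lemma sum_pair_weight_insert_at_tail:
  assumes "a \<notin> set (y # w)"
  shows "(\<Sum>j\<le>length w. pair_weight (y # insert_at a j w)) =
    of_nat (Suc (length w)) * pair_weight (y # w) + (1 - X) * pderiv (pair_weight (y # w))"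
  using assms
proof (induction w arbitrary: y)
  case Nil
  then show ?case
    by (auto simp: pair_weight_def)
next
  case (Cons z w)
  define M where "M = pair_weight (z # w)"
  \<comment> \<open>The factor contributed by the leading pair \<open>y\<close>, \<open>z\<close>.
    It is lost exactly when \<open>a\<close> is placed between them.\<close>
  define d where "d = (if y = z then X else 1)"
  have IH: "(\<Sum>j\<le>length w. pair_weight (z # insert_at a j w)) =
      of_nat (Suc (length w)) * M + (1 - X) * pderiv M"
    unfolding M_def using Cons.prems by (intro Cons.IH) auto
  have first: "pair_weight (y # a # z # w) = M"
    using Cons.prems by (auto simp: pair_weight_def M_def)
  have later: "pair_weight (y # z # v) = d * pair_weight (z # v)" for v
    by (auto simp: pair_weight_def d_def)
  have "(\<Sum>j\<le>length (z # w). pair_weight (y # insert_at a j (z # w))) =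
      M + d * (\<Sum>j\<le>length w. pair_weight (z # insert_at a j w))"
    by (simp add: sum.atMost_Suc_shift first later sum_distrib_left del: sum.atMost_Suc)
  also have "\<dots> = M + d * (of_nat (Suc (length w)) * M + (1 - X) * pderiv M)"
    by (simp only: IH)
  also have "\<dots> = of_nat (Suc (length (z # w))) * (d * M) + (1 - X) * pderiv (d * M)"
  proof (cases "y = z")
    case True
    have "pderiv X = 1"
      by (simp add: pderiv_pCons)
    then have "pderiv (X * M) = M + X * pderiv M"
      by (simp only: pderiv_mult mult_1_right add.commute)
    moreover have "d = X"
      using True by (simp add: d_def)
    \<comment> \<open>A ring identity in variables: the literal \<open>[:0, 1:]\<close> behind
      \<open>X\<close> would otherwise be multiplied out.\<close>
    moreover have "M + x * ((1 + l) * M + (1 - x) * M') =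
        (1 + (1 + l)) * (x * M) + (1 - x) * (M + x * M')" for x l M' :: "int poly"
      by (simp add: algebra_simps)
    ultimately show ?thesis
      by (simp only: length_Cons of_nat_Suc)
  next
    case False
    then show ?thesis
      by (simp add: d_def algebra_simps)
  qed
  finally show ?case
    by (simp only: later M_def)
qed

text \<open>The front slot creates the pair \<open>a\<close>, \<open>a\<close> and gives the term
  with \<open>X\<close>; in every other slot the leading \<open>a\<close> forms no pair, so the
  count for the tail applies.\<close>

lemma sum_pair_weight_insert_at:
  assumes "a \<notin> set w"
  shows "(\<Sum>j\<le>length w. pair_weight (a # insert_at a j w)) =
    (X + of_nat (length w)) * pair_weight w + (1 - X) * pderiv (pair_weight w)"
proof (cases w)
  case Nil
  then show ?thesis
    by (simp add: pair_weight_def)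
next
  case (Cons y v)
  have "pair_weight (a # a # y # v) = X * pair_weight w"
    using assms Cons by (auto simp: pair_weight_def)
  moreover have "pair_weight (a # y # insert_at a j v) = pair_weight (y # insert_at a j v)" for j
    using assms Cons by (auto simp: pair_weight_def)
  ultimately have "(\<Sum>j\<le>length w. pair_weight (a # insert_at a j w)) =
      X * pair_weight w + (\<Sum>j\<le>length v. pair_weight (y # insert_at a j v))"
    by (simp add: Cons sum.atMost_Suc_shift del: sum.atMost_Suc)
  then show ?thesis
    using sum_pair_weight_insert_at_tail[OF assms[unfolded Cons]]
    by (simp only: Cons length_Cons distrib_right add.assoc)
qed

section \<open>The order of first occurrences\<close>

definition precedes :: "'a list \<Rightarrow> 'a \<Rightarrow> 'a \<Rightarrow> bool" where
  "precedes w i j \<longleftrightarrow> i \<in> set (takeWhile (\<lambda>x. x \<noteq> j) w)"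

lemma first_occ_eq_length_takeWhile:
  assumes "i \<in> set w"
  shows "first_occ w i = length (takeWhile (\<lambda>x. x \<noteq> i) w)"
  unfolding first_occ_def
proof (rule Least_equality)
  have "length (takeWhile (\<lambda>x. x \<noteq> i) w) < length w"
    using assms by (induction w) auto
  then show "length (takeWhile (\<lambda>x. x \<noteq> i) w) < length w \<and>
      w ! length (takeWhile (\<lambda>x. x \<noteq> i) w) = i"
    using nth_length_takeWhile[of "\<lambda>x. x \<noteq> i" w] by simp
  fix j assume "j < length w \<and> w ! j = i"
  then show "length (takeWhile (\<lambda>x. x \<noteq> i) w) \<le> j"
    using takeWhile_nth[of j "\<lambda>x. x \<noteq> i" w] nth_mem[of j "takeWhile (\<lambda>x. x \<noteq> i) w"]
    by (meson not_le set_takeWhileD)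
qed

text \<open>Replaces positions by membership in a prefix, which is stable under relabelling and
  under insertion of other symbols. An absent symbol counts as last for \<open>precedes\<close>, but
  has an unspecified \<open>first_occ\<close>.\<close>

lemma first_occ_less_iff_precedes:
  assumes "i \<in> set w" "j \<in> set w"
  shows "first_occ w i < first_occ w j \<longleftrightarrow> precedes w i j"
proof -
  have "length (takeWhile (\<lambda>x. x \<noteq> i) w) < length (takeWhile (\<lambda>x. x \<noteq> j) w) \<longleftrightarrow> precedes w i j"
    using assms unfolding precedes_def by (induction w) auto
  then show ?thesis
    using assms by (simp add: first_occ_eq_length_takeWhile)
qed

lemma precedes_insert_at:
  assumes "a \<noteq> i" "a \<noteq> j"
  shows "precedes (insert_at a k w) i j \<longleftrightarrow> precedes w i j"
proof -
  have "precedes (u @ a # v) i j \<longleftrightarrow> precedes (u @ v) i j" for u v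
    using assms by (induction u) (auto simp: precedes_def)
  then show ?thesis
    by (metis append_take_drop_id insert_at_def)
qed

lemma precedes_map: "inj f \<Longrightarrow> precedes (map f w) (f i) (f j) \<longleftrightarrow> precedes w i j"
  by (auto simp: precedes_def takeWhile_map comp_def inj_eq)

section \<open>Ordered words and the bijection that adds a new smallest symbol\<close>

definition ordered_words :: "nat \<Rightarrow> nat list set" where
  "ordered_words n = {w \<in> multiperm_words 2 n. ordered_word n w}"

lemma set_multiperm_words:
  assumes "w \<in> multiperm_words k n" "k > 0"
  shows "set w = {1..n}"
proof (intro equalityI subsetI)
  fix i assume "i \<in> {1..n}"
  then have "count_list w i \<noteq> 0"
    using assms by (simp add: multiperm_words_def)
  then show "i \<in> set w"
    by (simp add: count_list_0_iff)
qed (use assms in \<open>auto simp: multiperm_words_def\<close>)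

text \<open>The multiplicity 2 is positive, so all of the symbols compared do occur and
  \<open>first_occ\<close> is meaningful.\<close>

lemma ordered_words_iff:
  "w \<in> ordered_words n \<longleftrightarrow>
     w \<in> multiperm_words 2 n \<and> (\<forall>i. 1 \<le> i \<and> i < n \<longrightarrow> precedes w i (Suc i))"
proof -
  have "first_occ w i < first_occ w (i + 1) \<longleftrightarrow> precedes w i (Suc i)"
    if "w \<in> multiperm_words 2 n" "1 \<le> i" "i < n" for i
    using that set_multiperm_words[OF that(1)] by (simp add: first_occ_less_iff_precedes)
  then show ?thesis
    by (auto simp: ordered_words_def ordered_word_def)
qed

lemma finite_ordered_words: "finite (ordered_words n)"
proof (rule finite_subset)
  show "ordered_words n \<subseteq> {w. set w \<subseteq> {1..n} \<and> length w = 2 * n}"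
    by (auto simp: ordered_words_def multiperm_words_def)
qed (simp add: finite_lists_length_eq)

lemma ordered_words_0: "ordered_words 0 = {[]}"
  by (auto simp: ordered_words_iff multiperm_words_def)

definition prepend_symbol :: "nat list \<Rightarrow> nat \<Rightarrow> nat list" where
  "prepend_symbol w j = 1 # insert_at 1 j (map Suc w)"

text \<open>Without a \<open>0\<close> in \<open>w\<close> there is no \<open>1\<close> in
  \<open>map Suc w\<close>, so the two added copies are the only ones.\<close>

lemma prepend_symbol_multiperm_iff:
  assumes "0 \<notin> set w"
  shows "prepend_symbol w j \<in> multiperm_words 2 (Suc n) \<longleftrightarrow> w \<in> multiperm_words 2 n"
proof -
  have count: "count_list (map Suc w) (Suc i) = count_list w i" for i
    by (induction w) auto
  have "count_list (map Suc w) (Suc 0) = 0"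
    using assms count[of 0] by (simp add: count_list_0_iff)
  moreover have "{1..Suc n} = insert 1 (Suc ` {1..n})"
    by auto
  moreover have "Suc ` set w \<subseteq> insert 1 (Suc ` {1..n}) \<longleftrightarrow> set w \<subseteq> {1..n}"
    using assms by auto
  ultimately show ?thesis
    by (simp add: multiperm_words_def prepend_symbol_def count del: image_Suc_atLeastAtMost)
qed

text \<open>The leading \<open>1\<close> settles the comparison of 1 with 2; every later comparison
  is one of \<open>w\<close> shifted by 1.\<close>

lemma prepend_symbol_ordered_iff:
  assumes "0 \<notin> set w"
  shows "prepend_symbol w j \<in> ordered_words (Suc n) \<longleftrightarrow> w \<in> ordered_words n"
proof -
  have first: "precedes (prepend_symbol w j) 1 (Suc 1)"
    by (simp add: prepend_symbol_def precedes_def)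
  have later: "precedes (prepend_symbol w j) (Suc i) (Suc (Suc i)) \<longleftrightarrow> precedes w i (Suc i)"
    if "1 \<le> i" for i
  proof -
    have "precedes (prepend_symbol w j) (Suc i) (Suc (Suc i)) \<longleftrightarrow>
        precedes (insert_at 1 j (map Suc w)) (Suc i) (Suc (Suc i))"
      using that by (simp add: prepend_symbol_def precedes_def)
    also have "\<dots> \<longleftrightarrow> precedes w i (Suc i)"
      using that by (simp add: precedes_insert_at precedes_map)
    finally show ?thesis .
  qed
  have "(\<forall>i. 1 \<le> i \<and> i < Suc n \<longrightarrow> precedes (prepend_symbol w j) i (Suc i)) \<longleftrightarrow>
      (\<forall>i. 1 \<le> i \<and> i < n \<longrightarrow> precedes w i (Suc i))" (is "?l \<longleftrightarrow> ?r")
  proof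
    assume ?l
    then show ?r
      using later by (meson Suc_less_eq le_SucI)
  next
    assume r: ?r
    show ?l
    proof (intro allI impI)
      fix i assume i: "1 \<le> i \<and> i < Suc n"
      show "precedes (prepend_symbol w j) i (Suc i)"
      proof (cases "i = 1")
        case True
        then show ?thesis
          using first by simp
      next
        case False
        then obtain k where "i = Suc k" "1 \<le> k"
          using i by (cases i) auto
        then show ?thesis
          using i r later by simp
      qed
    qed
  qed
  then show ?thesis
    using assms by (simp add: ordered_words_iff prepend_symbol_multiperm_iff)
qed

lemma ordered_words_Suc_decompose:
  assumes "u \<in> ordered_words (Suc n)"
  obtains w j where "u = prepend_symbol w j" "0 \<notin> set w" "j \<le> length w"
proof -
  have u: "u \<in> multiperm_words 2 (Suc n)"
    and prec: "\<And>i. 1 \<le> i \<Longrightarrow> i < Suc n \<Longrightarrow> precedes u i (Suc i)"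
    using assms by (auto simp: ordered_words_iff)
  obtain x v where xv: "u = x # v"
    using u by (cases u) (auto simp: multiperm_words_def)
  have x: "x \<in> {1..Suc n}"
    using u xv by (auto simp: multiperm_words_def)
  \<comment> \<open>Nothing precedes the head of a word, so a head \<open>x > 1\<close> would
    contradict \<open>x - 1\<close> preceding \<open>x\<close>.\<close>
  have "x = 1"
  proof (rule ccontr)
    assume "x \<noteq> 1"
    then have "precedes u (x - 1) x"
      using x prec[of "x - 1"] by auto
    then show False
      by (simp add: precedes_def xv)
  qed
  have "count_list u 1 = 2"
    using u by (simp add: multiperm_words_def)
  then have cnt: "count_list v 1 = 1"
    using xv \<open>x = 1\<close> by simp
  then have "1 \<in> set v"
    using count_list_0_iff[of v 1] by auto
  then obtain a b where ab: "v = a @ 1 # b"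
    by (auto dest: split_list)
  then have "1 \<notin> set (a @ b)"
    using cnt by (simp add: count_list_0_iff)
  moreover have "0 \<notin> set (a @ b)"
    using u xv ab by (auto simp: multiperm_words_def)
  ultimately have pos: "y \<ge> 2" if "y \<in> set (a @ b)" for y
    using that by (metis One_nat_def less_2_cases not_less)
  \<comment> \<open>Deletes both copies of 1 and lowers the rest. All remaining entries are at least
    2, so \<open>Suc\<close> undoes the truncated subtraction.\<close>
  define w where "w = map (\<lambda>y. y - 1) (a @ b)"
  have "map Suc w = a @ b"
    unfolding w_def map_map using pos by (intro map_idI) fastforce
  then have "u = prepend_symbol w (length a)"
    using xv ab \<open>x = 1\<close> by (simp add: prepend_symbol_def insert_at_def)
  moreover have "0 \<notin> set w" "length a \<le> length w"
    using pos by (fastforce simp: w_def)+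
  ultimately show ?thesis
    using that by blast
qed

lemma bij_betw_prepend_symbol:
  "bij_betw (\<lambda>(w, j). prepend_symbol w j) (ordered_words n \<times> {..2 * n}) (ordered_words (Suc n))"
proof -
  have props: "0 \<notin> set w" "length w = 2 * n" if "w \<in> ordered_words n" for w
    using that by (auto simp: ordered_words_def multiperm_words_def)
  have "inj_on (\<lambda>(w, j). prepend_symbol w j) (ordered_words n \<times> {..2 * n})"
  proof (rule inj_onI, clarify)
    fix v j w k
    assume "v \<in> ordered_words n" "j \<le> 2 * n" "w \<in> ordered_words n" "k \<le> 2 * n"
      and "prepend_symbol v j = prepend_symbol w k"
    then have "map Suc v = map Suc w \<and> j = k"
      using props insert_at_inject[of 1 "map Suc v" "map Suc w" j k]
      by (auto simp: prepend_symbol_def)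
    then show "v = w \<and> j = k"
      by (simp add: inj_map_eq_map)
  qed
  moreover have "(\<lambda>(w, j). prepend_symbol w j) ` (ordered_words n \<times> {..2 * n}) =
      ordered_words (Suc n)"
  proof (intro equalityI subsetI)
    fix u assume "u \<in> (\<lambda>(w, j). prepend_symbol w j) ` (ordered_words n \<times> {..2 * n})"
    then show "u \<in> ordered_words (Suc n)"
      using props by (auto simp: prepend_symbol_ordered_iff)
  next
    fix u assume u: "u \<in> ordered_words (Suc n)"
    then obtain w j where wj: "u = prepend_symbol w j" "0 \<notin> set w" "j \<le> length w"
      by (rule ordered_words_Suc_decompose)
    then have "w \<in> ordered_words n"
      using u by (simp add: prepend_symbol_ordered_iff)
    then show "u \<in> (\<lambda>(w, j). prepend_symbol w j) ` (ordered_words n \<times> {..2 * n})"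
      using wj props by (intro image_eqI[of _ _ "(w, j)"]) auto
  qed
  ultimately show ?thesis
    by (simp add: bij_betw_def)
qed

section \<open>Recurrences for the generating polynomial \<open>W\<^sub>n\<close>\<close>

definition pair_poly :: "nat \<Rightarrow> int poly" where
  "pair_poly n = (\<Sum>w\<in>ordered_words n. pair_weight w)"

lemma pair_poly_0: "pair_poly 0 = 1"
  by (simp add: pair_poly_def ordered_words_0 pair_weight_def)

lemma pair_poly_Suc:
  "pair_poly (Suc n) = (X + of_nat (2 * n)) * pair_poly n + (1 - X) * pderiv (pair_poly n)"
proof -
  have inner: "(\<Sum>j\<le>2 * n. pair_weight (prepend_symbol w j)) =
      (X + of_nat (2 * n)) * pair_weight w + (1 - X) * pderiv (pair_weight w)"
    if "w \<in> ordered_words n" for w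
  proof -
    have "1 \<notin> set (map Suc w)" "length (map Suc w) = 2 * n"
      using that by (auto simp: ordered_words_def multiperm_words_def)
    moreover have "pair_weight (map Suc w) = pair_weight w"
      by (simp add: pair_weight_def adj_pairs_map)
    ultimately show ?thesis
      using sum_pair_weight_insert_at[of 1 "map Suc w"] by (simp only: prepend_symbol_def simp_thms)
  qed
  have "pair_poly (Suc n) =
      (\<Sum>(w, j)\<in>ordered_words n \<times> {..2 * n}. pair_weight (prepend_symbol w j))"
    unfolding pair_poly_def
    using sum.reindex_bij_betw[OF bij_betw_prepend_symbol, of pair_weight]
    by (simp add: case_prod_unfold)
  also have "\<dots> = (\<Sum>w\<in>ordered_words n. \<Sum>j\<le>2 * n. pair_weight (prepend_symbol w j))"
    by (rule sum.cartesian_product[symmetric])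
  also have "\<dots> = (X + of_nat (2 * n)) * pair_poly n + (1 - X) * pderiv (pair_poly n)"
    \<comment> \<open>The first-order instance of \<open>higher_pderiv_sum\<close> moves
      \<open>pderiv\<close> inside the finite sum.\<close>
    unfolding pair_poly_def higher_pderiv_sum[of 1, simplified] sum_distrib_left
    by (simp only: inner sum.distrib cong: sum.cong)
  finally show ?thesis .
qed

text \<open>Trades the derivative for the preceding polynomial, turning the differential recurrence
  into a three-term one. The induction differentiates that recurrence.\<close>

lemma pderiv_pair_poly_Suc:
  "pderiv (pair_poly (Suc n)) = pair_poly (Suc n) + (1 - X) * pair_poly n"
proof (induction n)
  case 0
  have "pair_poly (Suc 0) = X"
    by (simp add: pair_poly_Suc pair_poly_0)
  then show ?case
    by (simp add: pair_poly_0 pderiv_pCons)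
next
  case (Suc n)
  define A B where "A = pair_poly n" and "B = pair_poly (Suc n)"
  define c :: "int poly" where "c = of_nat (2 * n)"
  have dX: "pderiv X = 1"
    by (simp add: pderiv_pCons)
  have c': "of_nat (2 * Suc n) = c + 2" "pderiv c = 0"
    by (simp_all add: c_def pderiv_of_nat del: of_nat_mult)
  have B: "B = (X + c) * A + (1 - X) * pderiv A"
    unfolding A_def B_def c_def by (rule pair_poly_Suc)
  have IH: "pderiv B = B + (1 - X) * A"
    using Suc by (simp only: A_def B_def)
  have IH': "pderiv (pderiv B) = pderiv B + ((1 - X) * pderiv A - A)"
    by (subst IH) (simp only: pderiv_add pderiv_mult pderiv_diff dX pderiv_1, algebra)
  have C: "pair_poly (Suc (Suc n)) = (X + (c + 2)) * B + (1 - X) * pderiv B"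
    unfolding B_def c'(1)[symmetric] by (rule pair_poly_Suc)
  have "pderiv (pair_poly (Suc (Suc n))) =
      B + (X + (c + 2)) * pderiv B - pderiv B + (1 - X) * pderiv (pderiv B)"
    unfolding C
    by (simp only: pderiv_add pderiv_mult pderiv_diff dX pderiv_1 c' pderiv_numeral) algebra
  also have "\<dots> = (X + (c + 2)) * B + (1 - X) * pderiv B + (1 - X) * B"
  proof -
    \<comment> \<open>The recurrence for \<open>B\<close>, solved for its derivative term,
      eliminates \<open>pderiv A\<close>; what remains is a polynomial identity in \<open>A\<close>
      and \<open>B\<close>.\<close>
    have "(1 - X) * pderiv A = B - (X + c) * A"
      unfolding B by (simp only: add_diff_cancel_left')
    moreover have "b + (x + (c + 2)) * (b + (1 - x) * a) - (b + (1 - x) * a) +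
        (1 - x) * (b + (1 - x) * a + (b - (x + c) * a - a)) =
        (x + (c + 2)) * b + (1 - x) * (b + (1 - x) * a) + (1 - x) * b" for x a b :: "int poly"
      by (simp add: algebra_simps)
    ultimately show ?thesis
      unfolding IH' unfolding IH by (simp only:)
  qed
  finally show ?case
    by (simp only: C B_def)
qed

text \<open>At 0 a power of \<open>X\<close> is 1 for exponent 0 and vanishes otherwise, so only
  words without adjacent equal entries survive.\<close>

lemma poly_pair_poly_0: "poly (pair_poly n) 0 = int (card (ordered_carlitz_words 2 n))"
proof -
  have "poly (pair_poly n) 0 = (\<Sum>w\<in>ordered_words n. if distinct_adj w then 1 else 0)"
    unfolding pair_poly_def poly_sum
    by (intro sum.cong) (auto simp: pair_weight_def power_0_left adj_pairs_eq_0_iff)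
  also have "\<dots> = int (card {w \<in> ordered_words n. distinct_adj w})"
    by (simp add: finite_ordered_words flip: sum.inter_filter)
  also have "{w \<in> ordered_words n. distinct_adj w} = ordered_carlitz_words 2 n"
    by (auto simp: ordered_words_def ordered_carlitz_words_def)
  finally show ?thesis .
qed

theorem theorem3p1:
  fixes p :: "nat \<Rightarrow> nat"
  assumes "p 0 = 1"
    and "p 1 = 0"
    and "\<And>n. n \<ge> 1 \<Longrightarrow> p (n + 1) = (2 * n + 1) * p n + p (n - 1)"
  shows "\<forall>n. p n = card (ordered_carlitz_words 2 n)"
proof
  fix n
  have "int (p n) = poly (pair_poly n) 0"
  proof (induction n rule: induct_nat_012)
    case 0
    show ?case
      using assms(1) by (simp add: pair_poly_0)
  next
    case 1
    show ?case
      using assms(2) by (simp add: pair_poly_Suc pair_poly_0)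
  next
    case (ge2 n)
    have "poly (pair_poly (Suc (Suc n))) 0 =
        2 * (int n + 1) * poly (pair_poly (Suc n)) 0 + poly (pderiv (pair_poly (Suc n))) 0"
      by (subst pair_poly_Suc) simp
    \<comment> \<open>At 0 the derivative is the sum of the two preceding values, which raises the
      coefficient from \<open>2n + 2\<close> to \<open>2n + 3 = 2(n + 1) + 1\<close>.\<close>
    also have "\<dots> = (2 * int n + 3) * int (p (Suc n)) + int (p n)"
      unfolding pderiv_pair_poly_Suc by (simp add: ge2 algebra_simps)
    also have "\<dots> = int (p (Suc (Suc n)))"
      using assms(3)[of "Suc n"] by (simp add: algebra_simps)
    finally show ?case ..
  qed
  then show "p n = card (ordered_carlitz_words 2 n)"
    by (simp add: poly_pair_poly_0)
qed

end
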